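(* Let $\mathsf{CS}$ be a constant specification for $\mathsf{S4LPN}$. Then $\mathsf{S4LPN}_{\mathsf{CS}}$ is sound and complete with respect to $\mathsf{S4LPN}_{\mathsf{CS}}$-models: a formula $F$ of $\mathsf{S4LPN}$ is a theorem of $\mathsf{S4LPN}_{\mathsf{CS}}$ if and only if $F$ is true in every $\mathsf{S4LPN}_{\mathsf{CS}}$-model.
   Context: Terms are built from justification variables and constants by binary $\cdot,+$ and unary $!$. Formulas are built from propositional variables and $\bot$ by $\neg,\wedge,\vee,\to$, $t:A$ ($t$ a term) and $\Box A$. $Tm$, $Fm$ denote the sets of terms and formulas. Axiom schemes of $\mathsf{S4LPN}$: propositional tautologies; $\Box(A\to B)\to(\Box A\to\Box B)$; $\Box A\to A$; $\Box A\to\Box\Box A$; $s:A\to(s+t):A$, $s:A\to(t+s):A$; $s:(A\to B)\to(t:A\to(s\cdot t):B)$; $t:A\to A$; $t:A\to\,!t:t:A$; $t:A\to\Box A$; $\neg t:A\to\Box\neg t:A$. A constant specification $\mathsf{CS}$ for $\mathsf{S4LPN}$ is a set of formulas $c:A$ with $c$ a constant and $A$ an axiom instance. $\mathsf{S4LPN}_{\mathsf{CS}}$ has these axioms, Modus Ponens, Necessitation (from $\vdash A$ infer $\vdash\Box A$), and the rule inferring any member of $\mathsf{CS}$. An $\mathsf{S4LPN}_{\mathsf{CS}}$-model is $\mathcal M=(\mathcal W,\mathcal R,\mathcal E,\mathcal V)$ with $\mathcal W\ne\emptyset$, $\mathcal R$ a reflexive transitive relation on $\mathcal W$, $\mathcal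 V$ a map from propositional variables to subsets of $\mathcal W$, and $\mathcal E:Tm\times Fm\to2^{\mathcal W}$ such that, with forcing defined by: $(\mathcal M,w)\Vdash P$ iff $w\in\mathcal V(P)$; Boolean connectives classical; $(\mathcal M,w)\Vdash t:F$ iff $w\in\mathcal E(t,F)$ and $(\mathcal M,v)\Vdash F$ for all $v$ with $w\mathcal Rv$; $(\mathcal M,w)\Vdash\Box A$ iff $(\mathcal M,v)\Vdash A$ for all $v$ with $w\mathcal Rv$; the following hold: $\mathcal E(c,F)=\mathcal W$ for all $c:F\in\mathsf{CS}$; $\mathcal E(s,A\to B)\cap\mathcal E(t,A)\subseteq\mathcal E(s\cdot t,B)$; $\mathcal E(s,A)\cup\mathcal E(t,A)\subseteq\mathcal E(s+t,A)$; if $w\in\mathcal E(t,A)$ and $w\mathcal Rv$ then $v\in\mathcal E(t,A)$; $\mathcal E(t,A)\subseteq\mathcal E(!t,t:A)$; (strong evidence) $w\in\mathcal E(t,A)$ implies $(\mathcal M,w)\Vdash t:A$; (anti-monotonicity) if $v\in\mathcal E(t,A)$ and $w\mathcal Rv$ then $w\in\mathcal E(t,A)$. A formula is true in $\mathcal M$ if it is forced at every world. *)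

theory Defs
  imports Main
begin

text \<open>
  Type parameters: \<open>'v\<close> justification variables, \<open>'c\<close> justification constants,
  \<open>'p\<close> propositional variables.
\<close>

datatype ('v, 'c) tm =
    JVar 'v
  | JConst 'c
  | App "('v, 'c) tm" "('v, 'c) tm" (infixl "\<^bold>\<cdot>" 95)
  | Plus "('v, 'c) tm" "('v, 'c) tm" (infixl "\<^bold>+" 90)
  | Bang "('v, 'c) tm" ("\<^bold>! _" [100] 100)

datatype ('v, 'c, 'p) fm =
    PVar 'p
  | Bot ("\<^bold>\<bottom>")
  | Neg "('v, 'c, 'p) fm" ("\<^bold>\<not> _" [80] 80)
  | Conj "('v, 'c, 'p) fm" "('v, 'c, 'p) fm" (infixr "\<^bold>\<and>" 75)
  | Disj "('v, 'c, 'p) fm" "('v, 'c, 'p) fm" (infixr "\<^bold>\<or>" 70)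
  | Imp "('v, 'c, 'p) fm" "('v, 'c, 'p) fm" (infixr "\<^bold>\<rightarrow>" 65)
  | Just "('v, 'c) tm" "('v, 'c, 'p) fm" (infixr "\<^bold>:" 85)
  | Box "('v, 'c, 'p) fm" ("\<^bold>\<box> _" [80] 80)

text \<open>
  Boolean evaluation: propositional variables and formulas of the form \<open>t \<^bold>: A\<close> and
  \<open>\<^bold>\<box> A\<close> are atoms, which receive arbitrary truth values from \<open>g\<close>. Hence
  \<open>tautology\<close> describes exactly the substitution instances, in the full language, of
  classical propositional tautologies.
\<close>

primrec bool_eval :: "(('v, 'c, 'p) fm \<Rightarrow> bool) \<Rightarrow> ('v, 'c, 'p) fm \<Rightarrow> bool" where
  "bool_eval g (PVar P) \<longleftrightarrow> g (PVar P)"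
| "bool_eval g \<^bold>\<bottom> \<longleftrightarrow> False"
| "bool_eval g (\<^bold>\<not> A) \<longleftrightarrow> \<not> bool_eval g A"
| "bool_eval g (A \<^bold>\<and> B) \<longleftrightarrow> bool_eval g A \<and> bool_eval g B"
| "bool_eval g (A \<^bold>\<or> B) \<longleftrightarrow> bool_eval g A \<or> bool_eval g B"
| "bool_eval g (A \<^bold>\<rightarrow> B) \<longleftrightarrow> (bool_eval g A \<longrightarrow> bool_eval g B)"
| "bool_eval g (t \<^bold>: A) \<longleftrightarrow> g (t \<^bold>: A)"
| "bool_eval g (\<^bold>\<box> A) \<longleftrightarrow> g (\<^bold>\<box> A)"

definition tautology :: "('v, 'c, 'p) fm \<Rightarrow> bool" where
  "tautology A \<longleftrightarrow> (\<forall>g. bool_eval g A)"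

inductive S4LPN_axiom :: "('v, 'c, 'p) fm \<Rightarrow> bool" where
  Taut: "tautology A \<Longrightarrow> S4LPN_axiom A"
| Box_K: "S4LPN_axiom (\<^bold>\<box> (A \<^bold>\<rightarrow> B) \<^bold>\<rightarrow> (\<^bold>\<box> A \<^bold>\<rightarrow> \<^bold>\<box> B))"
| Box_T: "S4LPN_axiom (\<^bold>\<box> A \<^bold>\<rightarrow> A)"
| Box_4: "S4LPN_axiom (\<^bold>\<box> A \<^bold>\<rightarrow> \<^bold>\<box> \<^bold>\<box> A)"
| Sum_left: "S4LPN_axiom (s \<^bold>: A \<^bold>\<rightarrow> (s \<^bold>+ t) \<^bold>: A)"
| Sum_right: "S4LPN_axiom (s \<^bold>: A \<^bold>\<rightarrow> (t \<^bold>+ s) \<^bold>: A)"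
| Application: "S4LPN_axiom (s \<^bold>: (A \<^bold>\<rightarrow> B) \<^bold>\<rightarrow> (t \<^bold>: A \<^bold>\<rightarrow> (s \<^bold>\<cdot> t) \<^bold>: B))"
| Factivity: "S4LPN_axiom (t \<^bold>: A \<^bold>\<rightarrow> A)"
| Introspection: "S4LPN_axiom (t \<^bold>: A \<^bold>\<rightarrow> \<^bold>! t \<^bold>: t \<^bold>: A)"
| Connection: "S4LPN_axiom (t \<^bold>: A \<^bold>\<rightarrow> \<^bold>\<box> A)"
| Neg_introspection: "S4LPN_axiom (\<^bold>\<not> (t \<^bold>: A) \<^bold>\<rightarrow> \<^bold>\<box> \<^bold>\<not> (t \<^bold>: A))"

definition constant_specification :: "('v, 'c, 'p) fm set \<Rightarrow> bool" where
  "constant_specification CS \<longleftrightarrow>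
     (\<forall>F \<in> CS. \<exists>c A. F = JConst c \<^bold>: A \<and> S4LPN_axiom A)"

inductive S4LPN_theorem :: "('v, 'c, 'p) fm set \<Rightarrow> ('v, 'c, 'p) fm \<Rightarrow> bool"
  for CS :: "('v, 'c, 'p) fm set" where
  Axiom: "S4LPN_axiom A \<Longrightarrow> S4LPN_theorem CS A"
| Modus_Ponens: "S4LPN_theorem CS (A \<^bold>\<rightarrow> B) \<Longrightarrow> S4LPN_theorem CS A \<Longrightarrow> S4LPN_theorem CS B"
| Necessitation: "S4LPN_theorem CS A \<Longrightarrow> S4LPN_theorem CS (\<^bold>\<box> A)"
| Constant: "F \<in> CS \<Longrightarrow> S4LPN_theorem CS F"

record ('w, 'v, 'c, 'p) kripke =
  Worlds :: "'w set"
  Acc :: "('w \<times> 'w) set"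
  Evid :: "('v, 'c) tm \<Rightarrow> ('v, 'c, 'p) fm \<Rightarrow> 'w set"
  Val :: "'p \<Rightarrow> 'w set"

primrec forces :: "('w, 'v, 'c, 'p) kripke \<Rightarrow> 'w \<Rightarrow> ('v, 'c, 'p) fm \<Rightarrow> bool" where
  "forces M w (PVar P) \<longleftrightarrow> w \<in> Val M P"
| "forces M w \<^bold>\<bottom> \<longleftrightarrow> False"
| "forces M w (\<^bold>\<not> A) \<longleftrightarrow> \<not> forces M w A"
| "forces M w (A \<^bold>\<and> B) \<longleftrightarrow> forces M w A \<and> forces M w B"
| "forces M w (A \<^bold>\<or> B) \<longleftrightarrow> forces M w A \<or> forces M w B"
| "forces M w (A \<^bold>\<rightarrow> B) \<longleftrightarrow> (forces M w A \<longrightarrow> forces M w B)"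
| "forces M w (t \<^bold>: A) \<longleftrightarrow> w \<in> Evid M t A \<and> (\<forall>v. (w, v) \<in> Acc M \<longrightarrow> forces M v A)"
| "forces M w (\<^bold>\<box> A) \<longleftrightarrow> (\<forall>v. (w, v) \<in> Acc M \<longrightarrow> forces M v A)"

definition S4LPN_model ::
    "('v, 'c, 'p) fm set \<Rightarrow> ('w, 'v, 'c, 'p) kripke \<Rightarrow> bool" where
  "S4LPN_model CS M \<longleftrightarrow>
     Worlds M \<noteq> {} \<and>
     Acc M \<subseteq> Worlds M \<times> Worlds M \<and> refl_on (Worlds M) (Acc M) \<and> trans (Acc M) \<and>
     (\<forall>P. Val M P \<subseteq> Worlds M) \<and>
     (\<forall>t A. Evid M t A \<subseteq> Worlds M) \<and>
     (\<forall>c F. JConst c \<^bold>: F \<in> CS \<longrightarrow> Evid M (JConst c) F = Worlds M) \<and>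
     (\<forall>s t A B. Evid M s (A \<^bold>\<rightarrow> B) \<inter> Evid M t A \<subseteq> Evid M (s \<^bold>\<cdot> t) B) \<and>
     (\<forall>s t A. Evid M s A \<union> Evid M t A \<subseteq> Evid M (s \<^bold>+ t) A) \<and>
     (\<forall>t A w v. w \<in> Evid M t A \<and> (w, v) \<in> Acc M \<longrightarrow> v \<in> Evid M t A) \<and>
     (\<forall>t A. Evid M t A \<subseteq> Evid M (\<^bold>! t) (t \<^bold>: A)) \<and>
     (\<forall>t A w. w \<in> Evid M t A \<longrightarrow> forces M w (t \<^bold>: A)) \<and>
     (\<forall>t A w v. v \<in> Evid M t A \<and> (w, v) \<in> Acc M \<longrightarrow> w \<in> Evid M t A)"

text \<open>
  HOL cannot quantify over all types of worlds within a formula. Worlds are therefore a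
  subset of a type parameter \<open>'w\<close>; soundness is to be read for every \<open>'w\<close>, whereas for
  completeness worlds that are sets of formulas already suffice.
\<close>

definition true_in :: "('w, 'v, 'c, 'p) kripke \<Rightarrow> ('v, 'c, 'p) fm \<Rightarrow> bool" where
  "true_in M F \<longleftrightarrow> (\<forall>w \<in> Worlds M. forces M w F)"

end

theory Submission
  imports Defs
begin

text \<open>
  Soundness is an induction on derivations. The only axioms that go beyond Kripke semantics are
  those for terms: factivity and connection hold because forcing \<open>t \<^bold>: A\<close> includes the truth of
  \<open>A\<close> at all accessible worlds, and negative introspection holds because evidence at an accessible
  world is evidence here (anti-monotonicity), hence a justification here (strong evidence).

  Completeness uses the canonical model, whose worlds are the maximal consistent sets. The usual
  accessibility relation (the unboxed part of \<open>W\<close> is contained in \<open>V\<close>) serves, and \<open>t\<close> is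
  evidence for \<open>A\<close> at \<open>W\<close> exactly when \<open>t \<^bold>: A \<in> W\<close>. Formulas \<open>t \<^bold>: A\<close> are then invariant along
  accessibility: forwards because \<open>t \<^bold>: A\<close> implies \<open>\<^bold>\<box> (t \<^bold>: A)\<close> by introspection and connection,
  backwards by negative introspection. The remaining point is the truth lemma, forcing equals
  membership; strong evidence is a consequence of it, since it identifies \<open>W \<in> Evid t A\<close> with \<open>W\<close>
  forcing \<open>t \<^bold>: A\<close>.

  The global rule of necessitation must not be applied to hypotheses. Derivability from a set of
  hypotheses is therefore generated from theorems and hypotheses by Modus Ponens alone. This makes
  the deduction theorem, compactness along chains, and the passage from a derivation of \<open>A\<close> from
  the unboxed part of \<open>W\<close> to \<open>\<^bold>\<box> A \<in> W\<close> all direct inductions.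
\<close>

section \<open>Soundness\<close>

text \<open>
  At a fixed world, forcing is itself a Boolean evaluation of the atoms, which is why
  tautologies are forced.
\<close>

lemma forces_iff_bool_eval: "forces M w A \<longleftrightarrow> bool_eval (forces M w) A"
  by (induction A) auto

lemma S4LPN_modelD:
  assumes "S4LPN_model CS M"
  shows "Acc M \<subseteq> Worlds M \<times> Worlds M"
    and "refl_on (Worlds M) (Acc M)"
    and "trans (Acc M)"
    and "\<forall>c F. JConst c \<^bold>: F \<in> CS \<longrightarrow> Evid M (JConst c) F = Worlds M"
    and "\<forall>s t A B. Evid M s (A \<^bold>\<rightarrow> B) \<inter> Evid M t A \<subseteq> Evid M (s \<^bold>\<cdot> t) B"
    and "\<forall>s t A. Evid M s A \<union> Evid M t A \<subseteq> Evid M (s \<^bold>+ t) A"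
    and "\<forall>t A. Evid M t A \<subseteq> Evid M (\<^bold>! t) (t \<^bold>: A)"
    and "\<forall>t A w. w \<in> Evid M t A \<longrightarrow> forces M w (t \<^bold>: A)"
    and "\<forall>t A w v. v \<in> Evid M t A \<and> (w, v) \<in> Acc M \<longrightarrow> w \<in> Evid M t A"
  using assms unfolding S4LPN_model_def by - (elim conjE, assumption)+

lemma axiom_forced:
  assumes M: "S4LPN_model CS M" and w: "w \<in> Worlds M" and A: "S4LPN_axiom A"
  shows "forces M w A"
proof -
  have refl: "(w, w) \<in> Acc M"
    using S4LPN_modelD(2)[OF M] w by (rule refl_onD)
  have trans: "(u, x) \<in> Acc M" if "(u, v) \<in> Acc M" "(v, x) \<in> Acc M" for u v x
    using S4LPN_modelD(3)[OF M] that by (rule transD)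
  have strong: "forces M u (t \<^bold>: B)" if "u \<in> Evid M t B" for t B u
    using S4LPN_modelD(8)[OF M] that by blast
  show ?thesis
    using A
  proof cases
    case Taut
    then show ?thesis
      using forces_iff_bool_eval unfolding tautology_def by metis
  next
    case (Box_4 B)
    then show ?thesis
      using trans by (simp only: forces.simps) blast
  next
    case (Sum_left s B t)
    have "Evid M s B \<subseteq> Evid M (s \<^bold>+ t) B"
      using S4LPN_modelD(6)[OF M] by blast
    then show ?thesis
      unfolding Sum_left by auto
  next
    case (Sum_right s B t)
    have "Evid M s B \<subseteq> Evid M (t \<^bold>+ s) B"
      using S4LPN_modelD(6)[OF M] by blast
    then show ?thesis
      unfolding Sum_right by auto
  next
    case (Application s B C t)
    have "Evid M s (B \<^bold>\<rightarrow> C) \<inter> Evid M t B \<subseteq> Evid M (s \<^bold>\<cdot> t) C"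
      using S4LPN_modelD(5)[OF M] by blast
    then show ?thesis
      unfolding Application by auto
  next
    case (Introspection t B)
    have "forces M w (\<^bold>! t \<^bold>: t \<^bold>: B)" if "w \<in> Evid M t B"
      using that S4LPN_modelD(7)[OF M] strong by blast
    then show ?thesis
      unfolding Introspection by simp
  next
    case (Neg_introspection t B)
    have "w \<in> Evid M t B" if "v \<in> Evid M t B" "(w, v) \<in> Acc M" for v
      using that S4LPN_modelD(9)[OF M] by blast
    then have "\<not> forces M v (t \<^bold>: B)" if "\<not> forces M w (t \<^bold>: B)" "(w, v) \<in> Acc M" for v
      using that strong[of w t B] by auto
    then show ?thesis
      unfolding Neg_introspection forces.simps(3,6,8) by blast
  qed (use refl in auto)
qed

theorem soundness:
  assumes "S4LPN_theorem CS F" and M: "S4LPN_model CS M"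
    and CS: "constant_specification CS"
  shows "true_in M F"
  using assms(1)
proof induction
  case (Axiom A)
  then show ?case
    using axiom_forced[OF M] by (simp add: true_in_def)
next
  case (Necessitation A)
  then show ?case
    using S4LPN_modelD(1)[OF M] by (auto simp: true_in_def)
next
  case (Constant F)
  then obtain c A where F: "F = JConst c \<^bold>: A"
    using CS by (auto simp: constant_specification_def)
  \<comment> \<open>The truth of \<open>A\<close> at accessible worlds comes from strong evidence.\<close>
  then have "Evid M (JConst c) A = Worlds M"
    using Constant S4LPN_modelD(4)[OF M] by blast
  then show ?case
    using S4LPN_modelD(8)[OF M] unfolding true_in_def F by blast
qed (simp add: true_in_def)

section \<open>Derivations from hypotheses\<close>

inductive derives :: "('v, 'c, 'p) fm set \<Rightarrow> ('v, 'c, 'p) fm set \<Rightarrow> ('v, 'c, 'p) fm \<Rightarrow> bool"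
  for CS S where
  Thm: "S4LPN_theorem CS A \<Longrightarrow> derives CS S A"
| Hyp: "A \<in> S \<Longrightarrow> derives CS S A"
| MP: "derives CS S (A \<^bold>\<rightarrow> B) \<Longrightarrow> derives CS S A \<Longrightarrow> derives CS S B"

lemma theorem_tautology: "(\<And>g. bool_eval g A) \<Longrightarrow> S4LPN_theorem CS A"
  by (simp add: S4LPN_theorem.Axiom S4LPN_axiom.Taut tautology_def)

lemma derives_empty: "derives CS {} A \<Longrightarrow> S4LPN_theorem CS A"
  by (induction rule: derives.induct) (auto intro: S4LPN_theorem.Modus_Ponens)

lemma derives_mono: "derives CS S A \<Longrightarrow> S \<subseteq> T \<Longrightarrow> derives CS T A"
  by (induction rule: derives.induct) (auto intro: derives.intros)

lemma derives_tautology1: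
  assumes "derives CS S A" and "\<And>g. bool_eval g (A \<^bold>\<rightarrow> B)"
  shows "derives CS S B"
  using assms by (meson derives.MP derives.Thm theorem_tautology)

lemma derives_tautology2:
  assumes "derives CS S A" and "derives CS S B" and "\<And>g. bool_eval g (A \<^bold>\<rightarrow> B \<^bold>\<rightarrow> C)"
  shows "derives CS S C"
  using assms by (meson derives.MP derives.Thm theorem_tautology)

lemma deduction_theorem: "derives CS (insert A S) B \<Longrightarrow> derives CS S (A \<^bold>\<rightarrow> B)"
proof (induction rule: derives.induct)
  case (Thm B)
  show ?case
    by (rule derives_tautology1[OF derives.Thm[OF Thm]]) simp
next
  case (Hyp B)
  then consider "B = A" | "B \<in> S"
    by blast
  then show ?case
  proof cases
    case 1
    then show ?thesis
      by (simp add: derives.Thm theorem_tautology)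
  next
    case 2
    show ?thesis
      by (rule derives_tautology1[OF derives.Hyp[OF 2]]) simp
  qed
next
  case (MP B C)
  show ?case
    by (rule derives_tautology2[OF MP.IH]) auto
qed

text \<open>
  Compactness in the form needed for Zorn's lemma: of the two members of the chain that supply
  the premises of an application of Modus Ponens, the larger supplies both.
\<close>

lemma derives_chain_Union:
  assumes "derives CS (\<Union>\<C>) A" and "\<C> \<noteq> {}"
    and chain: "\<And>S T. S \<in> \<C> \<Longrightarrow> T \<in> \<C> \<Longrightarrow> S \<subseteq> T \<or> T \<subseteq> S"
  shows "\<exists>S\<in>\<C>. derives CS S A"
  using assms(1)
proof induction
  case (Thm A)
  then show ?case
    using \<open>\<C> \<noteq> {}\<close> by (auto intro: derives.Thm)
next
  case (Hyp A)
  then show ?case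
    by (auto intro: derives.Hyp)
next
  case (MP A B)
  then obtain S T where "S \<in> \<C>" "derives CS S (A \<^bold>\<rightarrow> B)" "T \<in> \<C>" "derives CS T A"
    by blast
  then show ?case
    using chain[of S T] by (metis derives.MP derives_mono)
qed

section \<open>Maximal consistent sets\<close>

text \<open>
  Consistency and maximality together are the single requirement that exactly one of \<open>A\<close> and
  \<open>\<^bold>\<not> A\<close> is a member.
\<close>

definition mcs :: "('v, 'c, 'p) fm set \<Rightarrow> ('v, 'c, 'p) fm set \<Rightarrow> bool" where
  "mcs CS W \<longleftrightarrow> (\<forall>A. derives CS W A \<longrightarrow> A \<in> W) \<and> (\<forall>A. \<^bold>\<not> A \<in> W \<longleftrightarrow> A \<notin> W)"

lemma mcs_theorem: "mcs CS W \<Longrightarrow> S4LPN_theorem CS A \<Longrightarrow> A \<in> W"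
  by (simp add: mcs_def derives.Thm)

lemma mcs_MP: "mcs CS W \<Longrightarrow> A \<^bold>\<rightarrow> B \<in> W \<Longrightarrow> A \<in> W \<Longrightarrow> B \<in> W"
  unfolding mcs_def by (meson derives.Hyp derives.MP)

lemma mcs_axiom: "mcs CS W \<Longrightarrow> S4LPN_axiom (A \<^bold>\<rightarrow> B) \<Longrightarrow> A \<in> W \<Longrightarrow> B \<in> W"
  by (meson S4LPN_theorem.Axiom mcs_MP mcs_theorem)

lemma mcs_Neg: "mcs CS W \<Longrightarrow> \<^bold>\<not> A \<in> W \<longleftrightarrow> A \<notin> W"
  by (simp add: mcs_def)

lemma mcs_tautology1:
  "mcs CS W \<Longrightarrow> A \<in> W \<Longrightarrow> (\<And>g. bool_eval g (A \<^bold>\<rightarrow> B)) \<Longrightarrow> B \<in> W"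
  by (meson mcs_MP mcs_theorem theorem_tautology)

lemma mcs_tautology2:
  "mcs CS W \<Longrightarrow> A \<in> W \<Longrightarrow> B \<in> W \<Longrightarrow> (\<And>g. bool_eval g (A \<^bold>\<rightarrow> B \<^bold>\<rightarrow> C)) \<Longrightarrow> C \<in> W"
  by (meson mcs_MP mcs_theorem theorem_tautology)

lemma mcs_Bot: "mcs CS W \<Longrightarrow> \<^bold>\<bottom> \<notin> W"
  using mcs_theorem[OF _ theorem_tautology, of CS W "\<^bold>\<not> \<^bold>\<bottom>"] mcs_Neg[of CS W "\<^bold>\<bottom>"]
  by simp

lemma mcs_Imp:
  assumes W: "mcs CS W"
  shows "A \<^bold>\<rightarrow> B \<in> W \<longleftrightarrow> (A \<in> W \<longrightarrow> B \<in> W)"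
proof
  assume "A \<in> W \<longrightarrow> B \<in> W"
  then consider "\<^bold>\<not> A \<in> W" | "B \<in> W"
    using mcs_Neg[OF W] by blast
  then show "A \<^bold>\<rightarrow> B \<in> W"
    by cases (auto elim!: mcs_tautology1[OF W])
qed (use mcs_MP[OF W] in blast)

lemma mcs_Conj:
  assumes W: "mcs CS W"
  shows "A \<^bold>\<and> B \<in> W \<longleftrightarrow> A \<in> W \<and> B \<in> W"
proof (intro iffI conjI)
  assume "A \<^bold>\<and> B \<in> W"
  then show "A \<in> W" "B \<in> W"
    by (auto elim!: mcs_tautology1[OF W])
next
  assume "A \<in> W \<and> B \<in> W"
  then show "A \<^bold>\<and> B \<in> W"
    by (auto intro: mcs_tautology2[OF W, of A B])
qed

lemma mcs_Disj:
  assumes W: "mcs CS W"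
  shows "A \<^bold>\<or> B \<in> W \<longleftrightarrow> A \<in> W \<or> B \<in> W"
proof
  assume AB: "A \<^bold>\<or> B \<in> W"
  have "B \<in> W" if "\<^bold>\<not> A \<in> W"
    by (rule mcs_tautology2[OF W AB that]) auto
  then show "A \<in> W \<or> B \<in> W"
    using mcs_Neg[OF W] by blast
next
  assume "A \<in> W \<or> B \<in> W"
  then show "A \<^bold>\<or> B \<in> W"
    by (auto elim!: mcs_tautology1[OF W])
qed

text \<open>
  A set that is maximal among those from which \<open>A\<close> is not derivable is maximal consistent: if
  neither \<open>B\<close> nor \<open>\<^bold>\<not> B\<close> were a member, both would imply \<open>A\<close> in its presence. Maximizing with
  respect to \<open>A\<close>, not with respect to \<open>\<^bold>\<bottom>\<close>, makes \<open>A \<notin> W\<close> part of the construction.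
\<close>

lemma lindenbaum:
  assumes "\<not> derives CS S A"
  obtains W where "mcs CS W" "S \<subseteq> W" "A \<notin> W"
proof -
  define P where "P = {T. S \<subseteq> T \<and> \<not> derives CS T A}"
  have "\<exists>W\<in>P. \<forall>T\<in>P. W \<subseteq> T \<longrightarrow> T = W"
  proof (rule subset_Zorn_nonempty)
    show "P \<noteq> {}"
      using assms by (auto simp: P_def)
  next
    fix \<C>
    assume ne: "\<C> \<noteq> {}" and chain: "subset.chain P \<C>"
    then have "\<not> derives CS (\<Union>\<C>) A"
      using derives_chain_Union[of CS \<C> A] unfolding subset_chain_def P_def by blast
    moreover have "S \<subseteq> \<Union>\<C>"
      using ne chain unfolding subset_chain_def P_def by blast
    ultimately show "\<Union>\<C> \<in> P"
      by (simp add: P_def)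
  qed
  then obtain W where SW: "S \<subseteq> W" and WA: "\<not> derives CS W A"
    and max: "\<And>T. W \<subseteq> T \<Longrightarrow> \<not> derives CS T A \<Longrightarrow> T = W"
    unfolding P_def by (smt (verit) mem_Collect_eq order_trans)
  have imp: "derives CS W (B \<^bold>\<rightarrow> A)" if "B \<notin> W" for B
    using max[of "insert B W"] that deduction_theorem by blast
  have closed: "B \<in> W" if "derives CS W B" for B
    using imp[of B] that WA derives.MP by blast
  have "\<^bold>\<not> B \<in> W \<longleftrightarrow> B \<notin> W" for B
  proof
    assume nB: "\<^bold>\<not> B \<in> W"
    have False if B: "B \<in> W"
    proof -
      have "derives CS W A"
        by (rule derives_tautology2[OF derives.Hyp[OF nB] derives.Hyp[OF B]]) auto
      then show False
        using WA by blast
    qed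
    then show "B \<notin> W"
      by blast
  next
    assume B: "B \<notin> W"
    have False if nB: "\<^bold>\<not> B \<notin> W"
    proof -
      have "derives CS W A"
        by (rule derives_tautology2[OF imp[OF B] imp[OF nB]]) auto
      then show False
        using WA by blast
    qed
    then show "\<^bold>\<not> B \<in> W"
      by blast
  qed
  then have "mcs CS W"
    using closed by (simp add: mcs_def)
  moreover have "A \<notin> W"
    using WA derives.Hyp by blast
  ultimately show thesis
    using that SW by blast
qed

section \<open>The canonical model\<close>

definition canonical ::
    "('v, 'c, 'p) fm set \<Rightarrow> (('v, 'c, 'p) fm set, 'v, 'c, 'p) kripke" where
  "canonical CS =
     \<lparr>Worlds = {W. mcs CS W},
      Acc = {(W, V). mcs CS W \<and> mcs CS V \<and> (\<forall>A. \<^bold>\<box> A \<in> W \<longrightarrow> A \<in> V)},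
      Evid = (\<lambda>t A. {W. mcs CS W \<and> t \<^bold>: A \<in> W}),
      Val = (\<lambda>P. {W. mcs CS W \<and> PVar P \<in> W})\<rparr>"

lemma canonical_simps:
  "W \<in> Worlds (canonical CS) \<longleftrightarrow> mcs CS W"
  "(W, V) \<in> Acc (canonical CS) \<longleftrightarrow> mcs CS W \<and> mcs CS V \<and> (\<forall>A. \<^bold>\<box> A \<in> W \<longrightarrow> A \<in> V)"
  "W \<in> Evid (canonical CS) t A \<longleftrightarrow> mcs CS W \<and> t \<^bold>: A \<in> W"
  "W \<in> Val (canonical CS) P \<longleftrightarrow> mcs CS W \<and> PVar P \<in> W"
  by (auto simp: canonical_def)

text \<open>
  Each step of a derivation from the unboxed part can be boxed: theorems by necessitation, and
  Modus Ponens by distribution of the box over implication.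
\<close>

lemma mcs_Box_derives:
  assumes W: "mcs CS W" and "derives CS {B. \<^bold>\<box> B \<in> W} A"
  shows "\<^bold>\<box> A \<in> W"
  using assms(2)
proof induction
  case (Thm A)
  then show ?case
    by (rule mcs_theorem[OF W S4LPN_theorem.Necessitation])
next
  case (MP A B)
  then show ?case
    using mcs_axiom[OF W S4LPN_axiom.Box_K] mcs_MP[OF W] by blast
qed simp

lemma mcs_Box_iff:
  assumes W: "mcs CS W"
  shows "\<^bold>\<box> A \<in> W \<longleftrightarrow> (\<forall>V. (W, V) \<in> Acc (canonical CS) \<longrightarrow> A \<in> V)"
proof
  assume R: "\<forall>V. (W, V) \<in> Acc (canonical CS) \<longrightarrow> A \<in> V"
  show "\<^bold>\<box> A \<in> W"
  proof (rule ccontr)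
    assume "\<^bold>\<box> A \<notin> W"
    then have "\<not> derives CS {B. \<^bold>\<box> B \<in> W} A"
      using mcs_Box_derives[OF W] by blast
    then obtain V where "mcs CS V" "{B. \<^bold>\<box> B \<in> W} \<subseteq> V" "A \<notin> V"
      by (rule lindenbaum)
    then show False
      using R W by (auto simp: canonical_simps)
  qed
qed (auto simp: canonical_simps)

lemma truth_lemma: "mcs CS W \<Longrightarrow> forces (canonical CS) W A \<longleftrightarrow> A \<in> W"
proof (induction A arbitrary: W)
  case (Just t A)
  have "A \<in> V" if "t \<^bold>: A \<in> W" "(W, V) \<in> Acc (canonical CS)" for V
    using that mcs_Box_iff[OF Just.prems] mcs_axiom[OF Just.prems S4LPN_axiom.Connection] by blast
  moreover have "mcs CS V" if "(W, V) \<in> Acc (canonical CS)" for V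
    using that by (simp add: canonical_simps)
  ultimately show ?case
    using Just.IH Just.prems by (auto simp: canonical_simps(3))
next
  case (Box A)
  have "mcs CS V" if "(W, V) \<in> Acc (canonical CS)" for V
    using that by (simp add: canonical_simps)
  then show ?case
    using Box.IH mcs_Box_iff[OF Box.prems] by auto
qed (simp_all add: canonical_simps mcs_Bot mcs_Neg mcs_Conj mcs_Disj mcs_Imp)

text \<open>
  This gives both monotonicity and anti-monotonicity of the canonical evidence function.
\<close>

lemma canonical_Evid_cong:
  assumes "(W, V) \<in> Acc (canonical CS)"
  shows "t \<^bold>: A \<in> W \<longleftrightarrow> t \<^bold>: A \<in> V"
proof
  have W: "mcs CS W" and V: "mcs CS V" and R: "\<And>B. \<^bold>\<box> B \<in> W \<Longrightarrow> B \<in> V"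
    using assms by (auto simp: canonical_simps)
  show "t \<^bold>: A \<in> V" if "t \<^bold>: A \<in> W"
    using that mcs_axiom[OF W S4LPN_axiom.Introspection]
      mcs_axiom[OF W S4LPN_axiom.Connection] R by blast
  show "t \<^bold>: A \<in> W" if "t \<^bold>: A \<in> V"
    using that mcs_axiom[OF W S4LPN_axiom.Neg_introspection] R mcs_Neg[OF W] mcs_Neg[OF V] by blast
qed

text \<open>
  The set of worlds is empty if the logic is inconsistent, so a maximal consistent set is
  supplied as a hypothesis.
\<close>

lemma canonical_model:
  assumes "mcs CS W\<^sub>0"
  shows "S4LPN_model CS (canonical CS)"
  unfolding S4LPN_model_def
proof (intro conjI allI impI)
  show "Worlds (canonical CS) \<noteq> {}"
    using assms canonical_simps(1) by blast
  show "refl_on (Worlds (canonical CS)) (Acc (canonical CS))"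
    unfolding refl_on_def Ball_def canonical_simps using mcs_axiom[OF _ S4LPN_axiom.Box_T] by auto
  show "trans (Acc (canonical CS))"
  proof (rule transI)
    fix U V W
    assume UV: "(U, V) \<in> Acc (canonical CS)" and VW: "(V, W) \<in> Acc (canonical CS)"
    then have U: "mcs CS U" and W: "mcs CS W"
      by (simp_all add: canonical_simps)
    have "A \<in> W" if "\<^bold>\<box> A \<in> U" for A
      using mcs_axiom[OF U S4LPN_axiom.Box_4 that] UV VW by (simp add: canonical_simps)
    then show "(U, W) \<in> Acc (canonical CS)"
      using U W by (simp add: canonical_simps)
  qed
  show "Evid (canonical CS) (JConst c) F = Worlds (canonical CS)" if "JConst c \<^bold>: F \<in> CS" for c F
    using mcs_theorem[OF _ S4LPN_theorem.Constant[OF that]] by (auto simp: canonical_simps)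
  show "Evid (canonical CS) s (A \<^bold>\<rightarrow> B) \<inter> Evid (canonical CS) t A
      \<subseteq> Evid (canonical CS) (s \<^bold>\<cdot> t) B" for s t A B
  proof
    fix W
    assume "W \<in> Evid (canonical CS) s (A \<^bold>\<rightarrow> B) \<inter> Evid (canonical CS) t A"
    then have W: "mcs CS W" and "s \<^bold>: (A \<^bold>\<rightarrow> B) \<in> W" "t \<^bold>: A \<in> W"
      by (auto simp: canonical_simps)
    then have "(s \<^bold>\<cdot> t) \<^bold>: B \<in> W"
      using mcs_MP[OF W mcs_axiom[OF W S4LPN_axiom.Application]] by blast
    then show "W \<in> Evid (canonical CS) (s \<^bold>\<cdot> t) B"
      using W by (simp add: canonical_simps)
  qed
  show "Evid (canonical CS) s A \<union> Evid (canonical CS) t A \<subseteq> Evid (canonical CS) (s \<^bold>+ t) A"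
    for s t A
    using mcs_axiom[OF _ S4LPN_axiom.Sum_left[of s A t]]
      mcs_axiom[OF _ S4LPN_axiom.Sum_right[of t A s]]
    by (auto simp: canonical_simps)
  show "Evid (canonical CS) t A \<subseteq> Evid (canonical CS) (\<^bold>! t) (t \<^bold>: A)" for t A
    using mcs_axiom[OF _ S4LPN_axiom.Introspection[of t A]] by (auto simp: canonical_simps)
  show "V \<in> Evid (canonical CS) t A"
    if "W \<in> Evid (canonical CS) t A \<and> (W, V) \<in> Acc (canonical CS)" for t A W V
    using that canonical_Evid_cong[of W V CS t A] by (simp add: canonical_simps)
  show "W \<in> Evid (canonical CS) t A"
    if "V \<in> Evid (canonical CS) t A \<and> (W, V) \<in> Acc (canonical CS)" for t A W V
    using that canonical_Evid_cong[of W V CS t A] by (simp add: canonical_simps)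
  show "forces (canonical CS) W (t \<^bold>: A)" if "W \<in> Evid (canonical CS) t A" for t A W
    using that truth_lemma[of CS W "t \<^bold>: A"] by (simp add: canonical_simps del: forces.simps)
qed (auto simp: canonical_simps)

theorem completeness:
  fixes CS :: "('v, 'c, 'p) fm set"
  assumes "\<And>M :: (('v, 'c, 'p) fm set, 'v, 'c, 'p) kripke. S4LPN_model CS M \<Longrightarrow> true_in M F"
  shows "S4LPN_theorem CS F"
proof (rule ccontr)
  assume "\<not> S4LPN_theorem CS F"
  then have "\<not> derives CS {} F"
    using derives_empty by blast
  then obtain W where W: "mcs CS W" and "F \<notin> W"
    by (rule lindenbaum)
  then have "\<not> forces (canonical CS) W F"
    using truth_lemma by blast
  then show False
    using assms[OF canonical_model[OF W]] W by (simp add: true_in_def canonical_simps)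
qed

theorem theorem10p7:
  fixes CS :: "('v, 'c, 'p) fm set" and F :: "('v, 'c, 'p) fm"
  assumes "constant_specification CS"
  shows "(S4LPN_theorem CS F \<longleftrightarrow>
            (\<forall>M :: (('v, 'c, 'p) fm set, 'v, 'c, 'p) kripke. S4LPN_model CS M \<longrightarrow> true_in M F)) \<and>
         (S4LPN_theorem CS F \<longrightarrow>
            (\<forall>M :: ('w, 'v, 'c, 'p) kripke. S4LPN_model CS M \<longrightarrow> true_in M F))"
proof (intro conjI iffI impI allI)
  show "S4LPN_theorem CS F"
    if "\<forall>M :: (('v, 'c, 'p) fm set, 'v, 'c, 'p) kripke. S4LPN_model CS M \<longrightarrow> true_in M F"
    by (rule completeness) (simp add: that)
qed (simp_all add: soundness assms)

end
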